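(* Let H1 $=i(x,i(y,x))$, H2 $=i(i(x,i(y,z)),i(i(x,y),i(x,z)))$, H3 $=i(i(x,n(x)),n(x))$, H4 $=i(x,i(n(x),y))$. Suppose $A$ is provable from H1–H4 using condensed detachment as the only rule of inference. Then $A$ has a proof from H1–H4 using condensed detachment in which no doubly negated formulas occur except those that occur as subformulas of $A$.
   Context: Formulas are terms built from propositional variables using the binary connective $i$ (implication) and the unary connective $n$ (negation). Condensed detachment: from a major premiss $i(A,B)$ and a minor premiss $C$, after renaming variables so that the two premisses share no variables, if $A$ and $C$ are unifiable with most general unifier $\sigma$, infer $B\sigma$. Alphabetic variants of axioms count as axioms, and conclusions may be renamed. A doubly negated formula is one of the form $n(n(t))$. *)

theory Defs
  imports Main
begin

datatype form = Var nat | Imp form form | Neg form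

primrec subst :: "(nat \<Rightarrow> form) \<Rightarrow> form \<Rightarrow> form" where
  "subst \<sigma> (Var x) = \<sigma> x"
| "subst \<sigma> (Imp a b) = Imp (subst \<sigma> a) (subst \<sigma> b)"
| "subst \<sigma> (Neg a) = Neg (subst \<sigma> a)"

primrec vars :: "form \<Rightarrow> nat set" where
  "vars (Var x) = {x}"
| "vars (Imp a b) = vars a \<union> vars b"
| "vars (Neg a) = vars a"

primrec subforms :: "form \<Rightarrow> form set" where
  "subforms (Var x) = {Var x}"
| "subforms (Imp a b) = insert (Imp a b) (subforms a \<union> subforms b)"
| "subforms (Neg a) = insert (Neg a) (subforms a)"

definition doubly_negated :: "form \<Rightarrow> bool" where
  "doubly_negated t \<longleftrightarrow> (\<exists>s. t = Neg (Neg s))"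

definition variant :: "form \<Rightarrow> form \<Rightarrow> bool" where
  "variant s t \<longleftrightarrow> (\<exists>f :: nat \<Rightarrow> nat. inj f \<and> t = subst (\<lambda>x. Var (f x)) s)"

definition unifier :: "(nat \<Rightarrow> form) \<Rightarrow> form \<Rightarrow> form \<Rightarrow> bool" where
  "unifier \<sigma> s t \<longleftrightarrow> subst \<sigma> s = subst \<sigma> t"

definition mgu :: "(nat \<Rightarrow> form) \<Rightarrow> form \<Rightarrow> form \<Rightarrow> bool" where
  "mgu \<sigma> s t \<longleftrightarrow> unifier \<sigma> s t \<and>
     (\<forall>\<tau>. unifier \<tau> s t \<longrightarrow> (\<exists>\<rho>. \<forall>x. \<tau> x = subst \<rho> (\<sigma> x)))"

definition cd :: "form \<Rightarrow> form \<Rightarrow> form \<Rightarrow> bool" where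
  "cd P Q R \<longleftrightarrow> (\<exists>P' Q' A B \<sigma>. variant P P' \<and> variant Q Q' \<and>
      vars P' \<inter> vars Q' = {} \<and> P' = Imp A B \<and> mgu \<sigma> A Q' \<and> variant (subst \<sigma> B) R)"

abbreviation "vx \<equiv> Var 0"
abbreviation "vy \<equiv> Var 1"
abbreviation "vz \<equiv> Var 2"

definition H1 :: form where "H1 = Imp vx (Imp vy vx)"
definition H2 :: form where
  "H2 = Imp (Imp vx (Imp vy vz)) (Imp (Imp vx vy) (Imp vx vz))"
definition H3 :: form where "H3 = Imp (Imp vx (Neg vx)) (Neg vx)"
definition H4 :: form where "H4 = Imp vx (Imp (Neg vx) vy)"

definition axioms :: "form set" where "axioms = {H1, H2, H3, H4}"

definition is_proof :: "form list \<Rightarrow> bool" where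
  "is_proof ps \<longleftrightarrow> ps \<noteq> [] \<and> (\<forall>k < length ps.
      (\<exists>h \<in> axioms. variant h (ps ! k)) \<or>
      (\<exists>i < k. \<exists>j < k. cd (ps ! i) (ps ! j) (ps ! k)))"

definition proof_of :: "form list \<Rightarrow> form \<Rightarrow> bool" where
  "proof_of ps A \<longleftrightarrow> is_proof ps \<and> last ps = A"

definition provable :: "form \<Rightarrow> bool" where
  "provable A \<longleftrightarrow> (\<exists>ps. proof_of ps A)"

end

theory Submission
  imports Defs
begin

text \<open>
  Modus ponens is the special case of condensed detachment in which the minor premise equals the
  antecedent of the major one, and detaching an axiom \<open>h\<close> from \<open>i(S,S)\<close> yields any prescribed
  instance \<open>S\<close> of \<open>h\<close>. So everything rests on deriving \<open>i(S,S)\<close> exactly, not merely some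
  generalisation of it. Condensed detachment renames the premises apart and thus
  tends to separate repeated variables; we prevent this by proving \<open>i(g,i(F,F))\<close> by induction on
  \<open>F\<close>, for one premise \<open>g = i(x1,i(x2,...,i(y,z)))\<close> listing all variables of \<open>S\<close>. Unifying the
  copies of \<open>g\<close> restores the sharing, and \<open>g\<close> is detached at the end by instantiating \<open>z\<close> with
  the theorem \<open>i(z,z)\<close>.

  It remains to find a modus ponens proof of \<open>A\<close> whose double negations all occur in \<open>A\<close>. No cut
  elimination is needed: the sets of hypotheses that are consistent for deductions
  restricted to formulas of this kind form a Kripke model in which forcing coincides with
  restricted deducibility, because the deduction theorem survives the restriction, and provable
  formulas are forced by soundness.
\<close>

section \<open>Substitution and condensed detachment\<close>

lemma subst_cong: "(\<And>x. x \<in> vars t \<Longrightarrow> \<sigma> x = \<tau> x) \<Longrightarrow> subst \<sigma> t = subst \<tau> t"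
  by (induction t) auto

lemma subst_eq_iff: "subst \<sigma> t = subst \<tau> t \<longleftrightarrow> (\<forall>x\<in>vars t. \<sigma> x = \<tau> x)"
  by (induction t) auto

lemma subst_Var [simp]: "subst Var t = t"
  by (induction t) auto

lemma subst_subst: "subst \<sigma> (subst \<tau> t) = subst (\<lambda>x. subst \<sigma> (\<tau> x)) t"
  by (induction t) auto

lemma subst_upd_fresh [simp]: "x \<notin> vars t \<Longrightarrow> subst (\<sigma>(x := s)) t = subst \<sigma> t"
  by (rule subst_cong) auto

lemma vars_subst: "vars (subst \<sigma> t) = (\<Union>x\<in>vars t. vars (\<sigma> x))"
  by (induction t) auto

lemma finite_vars [simp]: "finite (vars t)"
  by (induction t) auto

lemma variant_refl [simp]: "variant t t"
  unfolding variant_def by (rule exI[of _ id]) auto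

lemma finite_fresh: "finite (X :: nat set) \<Longrightarrow> \<exists>x. x \<notin> X"
  by (rule ex_new_if_finite) auto

text \<open>Giving each premise its own substitution hides the renaming apart: inside the proof the
  variables of the major premise become even, those of the minor one odd. Most generality is then
  checked only on variables of the premises.\<close>

lemma cdI:
  assumes unif: "subst \<sigma>1 A = subst \<sigma>2 Q"
    and mg: "\<And>\<tau>1 \<tau>2. subst \<tau>1 A = subst \<tau>2 Q \<Longrightarrow>
      \<exists>\<rho>. (\<forall>x\<in>vars (Imp A B). \<tau>1 x = subst \<rho> (\<sigma>1 x)) \<and> (\<forall>x\<in>vars Q. \<tau>2 x = subst \<rho> (\<sigma>2 x))"
  shows "cd (Imp A B) Q (subst \<sigma>1 B)"
proof -
  define V where "V = (\<Union>x\<in>vars (Imp A B). vars (\<sigma>1 x)) \<union> (\<Union>x\<in>vars Q. vars (\<sigma>2 x))"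
  have "finite V" unfolding V_def by auto
  then obtain N where N: "\<And>y. y \<in> V \<Longrightarrow> y < N"
    using finite_nat_set_iff_bounded by auto
  define l :: "nat \<Rightarrow> nat" where "l x = 2 * x" for x
  define r :: "nat \<Rightarrow> nat" where "r x = 2 * x + 1" for x
  \<comment> \<open>\<open>mgu\<close> demands a factorisation at every variable. Variables of
    neither renamed premise are therefore shifted past \<open>V\<close>, where
    \<open>\<rho>'\<close> below is free to copy \<open>\<tau>\<close>.\<close>
  define \<sigma> where "\<sigma> x = (if even x \<and> x div 2 \<in> vars (Imp A B) then \<sigma>1 (x div 2)
      else if odd x \<and> x div 2 \<in> vars Q then \<sigma>2 (x div 2) else Var (x + N))" for x
  define P' where "P' = subst (\<lambda>x. Var (l x)) (Imp A B)"
  define Q' where "Q' = subst (\<lambda>x. Var (r x)) Q"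
  have \<sigma>l: "\<sigma> (l x) = \<sigma>1 x" if "x \<in> vars (Imp A B)" for x
    using that by (simp add: \<sigma>_def l_def)
  have \<sigma>r: "\<sigma> (r x) = \<sigma>2 x" if "x \<in> vars Q" for x
    using that by (simp add: \<sigma>_def r_def)
  have A: "subst \<sigma> (subst (\<lambda>x. Var (l x)) A) = subst \<sigma>1 A"
    unfolding subst_subst by (rule subst_cong) (simp add: \<sigma>l)
  have B: "subst \<sigma> (subst (\<lambda>x. Var (l x)) B) = subst \<sigma>1 B"
    unfolding subst_subst by (rule subst_cong) (simp add: \<sigma>l)
  have Q: "subst \<sigma> Q' = subst \<sigma>2 Q"
    unfolding subst_subst Q'_def by (rule subst_cong) (simp add: \<sigma>r)
  have "mgu \<sigma> (subst (\<lambda>x. Var (l x)) A) Q'"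
    unfolding mgu_def unifier_def
  proof (intro conjI allI impI)
    show "subst \<sigma> (subst (\<lambda>x. Var (l x)) A) = subst \<sigma> Q'"
      using A Q unif by simp
  next
    fix \<tau> assume "subst \<tau> (subst (\<lambda>x. Var (l x)) A) = subst \<tau> Q'"
    then have "subst (\<lambda>x. \<tau> (l x)) A = subst (\<lambda>x. \<tau> (r x)) Q"
      by (simp add: subst_subst Q'_def)
    from mg[OF this] obtain \<rho> where
      \<rho>: "\<And>x. x \<in> vars (Imp A B) \<Longrightarrow> \<tau> (l x) = subst \<rho> (\<sigma>1 x)"
         "\<And>x. x \<in> vars Q \<Longrightarrow> \<tau> (r x) = subst \<rho> (\<sigma>2 x)" by blast
    define \<rho>' where "\<rho>' y = (if y < N then \<rho> y else \<tau> (y - N))" for y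
    have ext: "subst \<rho>' s = subst \<rho> s" if "vars s \<subseteq> V" for s
      using that N by (intro subst_cong) (auto simp: \<rho>'_def)
    have "\<tau> x = subst \<rho>' (\<sigma> x)" for x
    proof -
      consider (l) y where "x = l y" "y \<in> vars (Imp A B)"
        | (r) y where "x = r y" "y \<in> vars Q" | (n) "\<sigma> x = Var (x + N)"
        unfolding \<sigma>_def l_def r_def by (metis dvd_mult_div_cancel odd_two_times_div_two_succ)
      then show ?thesis
      proof cases
        case l
        then have "vars (\<sigma>1 y) \<subseteq> V" unfolding V_def by blast
        then show ?thesis using l \<sigma>l \<rho>(1) ext by simp
      next
        case r
        then have "vars (\<sigma>2 y) \<subseteq> V" unfolding V_def by blast
        then show ?thesis using r \<sigma>r \<rho>(2) ext by simp
      next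
        case n
        then show ?thesis by (simp add: \<rho>'_def)
      qed
    qed
    then show "\<exists>\<rho>. \<forall>x. \<tau> x = subst \<rho> (\<sigma> x)" by blast
  qed
  moreover have "variant (Imp A B) P'"
    unfolding variant_def P'_def by (rule exI[of _ l]) (auto simp: inj_on_def l_def)
  moreover have "variant Q Q'"
    unfolding variant_def Q'_def by (rule exI[of _ r]) (auto simp: inj_on_def r_def)
  moreover have "vars P' \<inter> vars Q' = {}"
    unfolding P'_def Q'_def vars_subst l_def r_def by auto presburger+
  ultimately show ?thesis
    unfolding cd_def using B variant_refl by (metis P'_def subst.simps(2))
qed

text \<open>A match of \<open>A\<close> onto \<open>Q\<close> is most general once the variables
  occurring only in \<open>B\<close> go to distinct variables outside \<open>Q\<close>: a competing
  unifier factors through \<open>\<tau>2\<close> on \<open>Q\<close>, and elsewhere by undoing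
  \<open>f\<close>.\<close>

lemma cd_match_minor:
  assumes "subst \<theta> A = Q"
    and "\<And>x. x \<in> vars B - vars A \<Longrightarrow> \<theta> x = Var (f x)"
    and "inj_on f (vars B - vars A)"
    and "\<And>x. x \<in> vars B - vars A \<Longrightarrow> f x \<notin> vars Q"
  shows "cd (Imp A B) Q (subst \<theta> B)"
proof (rule cdI[where ?\<sigma>2.0 = Var])
  fix \<tau>1 \<tau>2 assume eq: "subst \<tau>1 A = subst \<tau>2 Q"
  define \<rho> where "\<rho> y = (if y \<in> vars Q then \<tau>2 y else \<tau>1 (the_inv_into (vars B - vars A) f y))" for y
  have "\<tau>1 x = subst \<rho> (\<theta> x)" if "x \<in> vars A" for x
  proof -
    have "\<tau>1 x = subst \<tau>2 (\<theta> x)"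
      using eq that unfolding assms(1)[symmetric] subst_subst subst_eq_iff by simp
    also have "\<dots> = subst \<rho> (\<theta> x)"
      using that assms(1) by (intro subst_cong) (auto simp: \<rho>_def vars_subst)
    finally show ?thesis .
  qed
  moreover have "\<tau>1 x = subst \<rho> (\<theta> x)" if "x \<in> vars B - vars A" for x
    using that assms(2,4)[OF that] the_inv_into_f_f[OF assms(3) that] by (simp add: \<rho>_def)
  ultimately show "\<exists>\<rho>. (\<forall>x\<in>vars (Imp A B). \<tau>1 x = subst \<rho> (\<theta> x)) \<and> (\<forall>x\<in>vars Q. \<tau>2 x = subst \<rho> (Var x))"
    by (intro exI[of _ \<rho>]) (auto simp: \<rho>_def)
qed (simp add: assms(1))

text \<open>The minor premise is the more general side, so the major one stays as it is and
  \<open>B\<close> comes out exactly. Modus ponens is the case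
  \<open>\<theta> = Var\<close>.\<close>

lemma cd_match_major: "cd (Imp (subst \<theta> Q) B) Q B"
proof -
  have "cd (Imp (subst \<theta> Q) B) Q (subst Var B)"
  proof (rule cdI[where ?\<sigma>2.0 = \<theta>])
    fix \<tau>1 \<tau>2 assume "subst \<tau>1 (subst \<theta> Q) = subst \<tau>2 Q"
    then show "\<exists>\<rho>. (\<forall>x\<in>vars (Imp (subst \<theta> Q) B). \<tau>1 x = subst \<rho> (Var x)) \<and> (\<forall>x\<in>vars Q. \<tau>2 x = subst \<rho> (\<theta> x))"
      by (intro exI[of _ \<tau>1]) (simp add: subst_subst subst_eq_iff)
  qed simp
  then show ?thesis by simp
qed


section \<open>Derivations with restricted double negations\<close>

text \<open>\<open>D\<close> is the set of permitted double negations. It stays arbitrary until the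
  end, where it becomes \<open>subforms A\<close>.\<close>

definition good :: "form set \<Rightarrow> form \<Rightarrow> bool" where
  "good D F \<longleftrightarrow> (\<forall>t\<in>subforms F. doubly_negated t \<longrightarrow> t \<in> D)"

lemma good_simps [simp]:
  "good D (Var x)"
  "good D (Imp a b) \<longleftrightarrow> good D a \<and> good D b"
  "good D (Neg (Var x))"
  by (auto simp: good_def doubly_negated_def)

lemma good_NegD: "good D (Neg a) \<Longrightarrow> good D a"
  by (simp add: good_def)

text \<open>Axioms are taken literally, since \<open>cd\<close> does all renaming. They contain no
  double negation, so only \<open>cd\<close> steps are checked.\<close>

inductive deriv :: "form set \<Rightarrow> form \<Rightarrow> bool" for D where
  ax: "h \<in> axioms \<Longrightarrow> deriv D h"
| cd: "deriv D P \<Longrightarrow> deriv D Q \<Longrightarrow> cd P Q R \<Longrightarrow> good D R \<Longrightarrow> deriv D R"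

lemma deriv_good: "deriv D F \<Longrightarrow> good D F"
  by (induction rule: deriv.induct) (auto simp: axioms_def H1_def H2_def H3_def H4_def)

section \<open>Turning derivations into proof lists\<close>

lemma is_proof_append:
  assumes "is_proof ps" "is_proof qs"
  shows "is_proof (ps @ qs)"
  unfolding is_proof_def
proof (intro conjI allI impI)
  show "ps @ qs \<noteq> []" using assms by (simp add: is_proof_def)
  fix k assume k: "k < length (ps @ qs)"
  show "(\<exists>h\<in>axioms. variant h ((ps @ qs) ! k)) \<or>
    (\<exists>i<k. \<exists>j<k. cd ((ps @ qs) ! i) ((ps @ qs) ! j) ((ps @ qs) ! k))"
  proof (cases "k < length ps")
    case True
    then have "(\<exists>h\<in>axioms. variant h (ps ! k)) \<or> (\<exists>i<k. \<exists>j<k. cd (ps ! i) (ps ! j) (ps ! k))"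
      using assms(1) by (simp add: is_proof_def)
    then show ?thesis using True by (fastforce simp: nth_append)
  next
    case False
    then obtain m where m: "k = length ps + m" "m < length qs"
      using k by (metis add_diff_inverse_nat length_append nat_add_left_cancel_less)
    then consider "\<exists>h\<in>axioms. variant h (qs ! m)" | i j where "i < m" "j < m" "cd (qs ! i) (qs ! j) (qs ! m)"
      using assms(2) unfolding is_proof_def by blast
    then show ?thesis
    proof cases
      case 1
      then show ?thesis using m by simp
    next
      case 2
      then have "cd ((ps @ qs) ! (length ps + i)) ((ps @ qs) ! (length ps + j)) ((ps @ qs) ! k)"
        using m by simp
      then show ?thesis using 2 m by (metis nat_add_left_cancel_less)
    qed
  qed
qed

lemma is_proof_snoc:
  assumes "is_proof ps" "P \<in> set ps" "Q \<in> set ps" "cd P Q R"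
  shows "is_proof (ps @ [R])"
  unfolding is_proof_def
proof (intro conjI allI impI)
  fix k assume k: "k < length (ps @ [R])"
  obtain i j where ij: "i < length ps" "P = ps ! i" "j < length ps" "Q = ps ! j"
    using assms(2,3) by (metis in_set_conv_nth)
  show "(\<exists>h\<in>axioms. variant h ((ps @ [R]) ! k)) \<or>
    (\<exists>i<k. \<exists>j<k. cd ((ps @ [R]) ! i) ((ps @ [R]) ! j) ((ps @ [R]) ! k))"
  proof (cases "k < length ps")
    case True
    then have "(\<exists>h\<in>axioms. variant h (ps ! k)) \<or> (\<exists>i<k. \<exists>j<k. cd (ps ! i) (ps ! j) (ps ! k))"
      using assms(1) by (simp add: is_proof_def)
    then show ?thesis using True by (fastforce simp: nth_append)
  next
    case False
    then have "k = length ps" using k by simp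
    moreover from this have "cd ((ps @ [R]) ! i) ((ps @ [R]) ! j) ((ps @ [R]) ! k)"
      using ij assms(4) by (simp add: nth_append)
    ultimately show ?thesis using ij by blast
  qed
qed simp

lemma deriv_proof: "deriv D F \<Longrightarrow> \<exists>ps. proof_of ps F \<and> (\<forall>G\<in>set ps. good D G)"
proof (induction rule: deriv.induct)
  case (ax h)
  then have "proof_of [h] h" unfolding proof_of_def is_proof_def by (auto intro!: bexI[of _ h])
  moreover have "good D h" using ax deriv.ax deriv_good by blast
  ultimately show ?case by (intro exI[of _ "[h]"]) simp
next
  case (cd P Q R)
  then obtain ps qs where *: "proof_of ps P" "proof_of qs Q"
    "\<forall>G\<in>set (ps @ qs). good D G" by auto
  then have "ps \<noteq> []" "qs \<noteq> []" by (auto simp: proof_of_def is_proof_def)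
  then have "P \<in> set (ps @ qs)" "Q \<in> set (ps @ qs)"
    using * by (auto simp: proof_of_def)
  then have "is_proof ((ps @ qs) @ [R])"
    using * cd.hyps by (intro is_proof_snoc is_proof_append) (auto simp: proof_of_def)
  then have "proof_of ((ps @ qs) @ [R]) R" by (simp add: proof_of_def)
  then show ?case using * cd.hyps by (intro exI[of _ "(ps @ qs) @ [R]"]) auto
qed

lemma deriv_match_minor:
  assumes "deriv D (Imp A B)" "deriv D Q" "subst \<theta> A = Q"
    and "\<And>x. x \<in> vars B - vars A \<Longrightarrow> \<theta> x = Var (f x)"
    and "inj_on f (vars B - vars A)"
    and "\<And>x. x \<in> vars B - vars A \<Longrightarrow> f x \<notin> vars Q"
    and "R = subst \<theta> B" "good D R"
  shows "deriv D R"
  using cd_match_minor[OF assms(3-6)] assms by (auto intro: deriv.cd)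

lemma deriv_unify:
  assumes "deriv D (Imp A B)" "deriv D Q" "subst \<sigma>1 A = subst \<sigma>2 Q"
    and "\<And>\<tau>1 \<tau>2. subst \<tau>1 A = subst \<tau>2 Q \<Longrightarrow>
      \<exists>\<rho>. (\<forall>x\<in>vars (Imp A B). \<tau>1 x = subst \<rho> (\<sigma>1 x)) \<and> (\<forall>x\<in>vars Q. \<tau>2 x = subst \<rho> (\<sigma>2 x))"
    and "R = subst \<sigma>1 B" "good D R"
  shows "deriv D R"
  using cdI[OF assms(3,4)] assms by (auto intro: deriv.cd)

lemma deriv_mp: "deriv D (Imp A B) \<Longrightarrow> deriv D A \<Longrightarrow> deriv D B"
  by (rule deriv.cd[OF _ _ cd_match_major[of Var, simplified]]) (use deriv_good in fastforce)+


section \<open>Implicational combinators\<close>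

lemma deriv_H1: "deriv D (Imp (Var 0) (Imp (Var 1) (Var 0)))"
  using deriv.ax[of H1 D] by (simp add: axioms_def H1_def)

lemma deriv_H2: "deriv D (Imp (Imp (Var 0) (Imp (Var 1) (Var 2)))
    (Imp (Imp (Var 0) (Var 1)) (Imp (Var 0) (Var 2))))"
  using deriv.ax[of H2 D] by (simp add: axioms_def H2_def)

lemma deriv_H3: "deriv D (Imp (Imp (Var 0) (Neg (Var 0))) (Neg (Var 0)))"
  using deriv.ax[of H3 D] by (simp add: axioms_def H3_def)

lemma deriv_H4: "deriv D (Imp (Var 0) (Imp (Neg (Var 0)) (Var 1)))"
  using deriv.ax[of H4 D] by (simp add: axioms_def H4_def)

text \<open>The second variable of \<open>H1\<close> remains free in this detachment, so the added
  antecedent is a new variable and not a formula of choice.\<close>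

lemma deriv_weaken:
  assumes "deriv D a" "v \<notin> vars a"
  shows "deriv D (Imp (Var v) a)"
  by (rule deriv_match_minor[OF deriv_H1 assms(1), where \<theta> = "Var(0 := a, 1 := Var v)" and f = "\<lambda>_. v"])
    (use assms deriv_good[OF assms(1)] in \<open>auto simp: inj_on_def\<close>)

lemma deriv_distrib:
  assumes "deriv D (Imp a (Imp b c))"
  shows "deriv D (Imp (Imp a b) (Imp a c))"
  by (rule deriv_match_minor[OF deriv_H2 assms, where \<theta> = "Var(0 := a, 1 := b, 2 := c)"])
    (use deriv_good[OF assms] in auto)

text \<open>The combinator identity B = S(KS)K, with \<open>H1\<close> as K and \<open>H2\<close> as
  S.\<close>

lemma deriv_B: "deriv D (Imp (Imp (Var 1) (Var 2)) (Imp (Imp (Var 0) (Var 1)) (Imp (Var 0) (Var 2))))"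
proof -
  have "deriv D (Imp (Imp (Var 3) (Imp (Var 0) (Imp (Var 1) (Var 2))))
      (Imp (Var 3) (Imp (Imp (Var 0) (Var 1)) (Imp (Var 0) (Var 2)))))"
    by (rule deriv_distrib, rule deriv_weaken[OF deriv_H2]) simp
  then show ?thesis
  \<comment> \<open>Neither formula is an instance of the other, so both premises get
    instantiated.\<close>
  proof (rule deriv_unify[OF _ deriv_H1])
    let ?\<sigma>1 = "Var(3 := Imp (Var 1) (Var 2))" and ?\<sigma>2 = "Var(0 := Imp (Var 1) (Var 2), 1 := Var 0)"
    show "subst ?\<sigma>1 (Imp (Var 3) (Imp (Var 0) (Imp (Var 1) (Var 2)))) = subst ?\<sigma>2 (Imp (Var 0) (Imp (Var 1) (Var 0)))"
      by simp
    show "Imp (Imp (Var 1) (Var 2)) (Imp (Imp (Var 0) (Var 1)) (Imp (Var 0) (Var 2))) =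
      subst ?\<sigma>1 (Imp (Var 3) (Imp (Imp (Var 0) (Var 1)) (Imp (Var 0) (Var 2))))"
      by simp
    show "\<exists>\<rho>. (\<forall>x\<in>vars (Imp (Imp (Var 3) (Imp (Var 0) (Imp (Var 1) (Var 2))))
        (Imp (Var 3) (Imp (Imp (Var 0) (Var 1)) (Imp (Var 0) (Var 2))))). \<tau>1 x = subst \<rho> (?\<sigma>1 x)) \<and>
      (\<forall>x\<in>vars (Imp (Var 0) (Imp (Var 1) (Var 0))). \<tau>2 x = subst \<rho> (?\<sigma>2 x))"
      if "subst \<tau>1 (Imp (Var 3) (Imp (Var 0) (Imp (Var 1) (Var 2)))) =
        subst \<tau>2 (Imp (Var 0) (Imp (Var 1) (Var 0)))" for \<tau>1 \<tau>2
      by (rule exI[of _ \<tau>1]) (use that in auto)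
  qed simp
qed

lemma deriv_compose_left:
  assumes "deriv D (Imp b c)" "v \<notin> vars b \<union> vars c"
  shows "deriv D (Imp (Imp (Var v) b) (Imp (Var v) c))"
  by (rule deriv_match_minor[OF deriv_B assms(1), where \<theta> = "Var(0 := Var v, 1 := b, 2 := c)" and f = "\<lambda>_. v"])
    (use assms deriv_good[OF assms(1)] in \<open>auto simp: inj_on_def\<close>)

text \<open>The combinator identity C = S(BBS)(KK).\<close>

lemma deriv_C: "deriv D (Imp (Imp (Var 0) (Imp (Var 1) (Var 2))) (Imp (Var 1) (Imp (Var 0) (Var 2))))"
proof -
  have "deriv D (Imp (Imp (Imp (Var 0) (Imp (Var 1) (Var 2))) (Imp (Var 3) (Imp (Var 0) (Var 1))))
      (Imp (Imp (Var 0) (Imp (Var 1) (Var 2))) (Imp (Var 3) (Imp (Var 0) (Var 2)))))" (is "deriv D (Imp ?A ?B)")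
  proof (rule deriv_distrib)
    show "deriv D (Imp (Imp (Var 0) (Imp (Var 1) (Var 2)))
      (Imp (Imp (Var 3) (Imp (Var 0) (Var 1))) (Imp (Var 3) (Imp (Var 0) (Var 2)))))"
      by (rule deriv_match_minor[OF deriv_compose_left[OF deriv_B, of 3] deriv_H2,
            where \<theta> = "Var(3 := Imp (Var 0) (Imp (Var 1) (Var 2)), 1 := Imp (Var 0) (Var 1),
              2 := Imp (Var 0) (Var 2), 0 := Var 3)" and f = "\<lambda>_. 3"]) (auto simp: inj_on_def)
  qed
  moreover have "deriv D (Imp (Var 2) (Imp (Var 0) (Imp (Var 1) (Var 0))))" (is "deriv D ?Q")
    by (rule deriv_weaken[OF deriv_H1]) simp
  ultimately show ?thesis
  proof (rule deriv_unify)
    let ?\<sigma>1 = "Var(3 := Var 1)"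
      and ?\<sigma>2 = "Var(2 := Imp (Var 0) (Imp (Var 1) (Var 2)), 0 := Var 1, 1 := Var 0)"
    show "subst ?\<sigma>1 ?A = subst ?\<sigma>2 ?Q" by simp
    show "Imp (Imp (Var 0) (Imp (Var 1) (Var 2))) (Imp (Var 1) (Imp (Var 0) (Var 2))) = subst ?\<sigma>1 ?B" by simp
    show "\<exists>\<rho>. (\<forall>x\<in>vars (Imp ?A ?B). \<tau>1 x = subst \<rho> (?\<sigma>1 x)) \<and> (\<forall>x\<in>vars ?Q. \<tau>2 x = subst \<rho> (?\<sigma>2 x))"
      if "subst \<tau>1 ?A = subst \<tau>2 ?Q" for \<tau>1 \<tau>2
      by (rule exI[of _ \<tau>1]) (use that in auto)
  qed simp
qed

lemma deriv_swap:
  assumes "deriv D (Imp a (Imp b c))"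
  shows "deriv D (Imp b (Imp a c))"
  by (rule deriv_match_minor[OF deriv_C assms, where \<theta> = "Var(0 := a, 1 := b, 2 := c)"])
    (use deriv_good[OF assms] in auto)

lemma deriv_B': "deriv D (Imp (Imp (Var 0) (Var 1)) (Imp (Imp (Var 1) (Var 2)) (Imp (Var 0) (Var 2))))"
  by (rule deriv_swap[OF deriv_B])

text \<open>The combinator SK; it replaces an arbitrary consequent by a copy of the
  antecedent.\<close>

lemma deriv_K_arg: "deriv D (Imp (Imp (Var 0) (Var 1)) (Imp (Var 0) (Var 0)))"
  by (rule deriv_distrib[OF deriv_H1])

lemma deriv_id: "deriv D (Imp (Var x) (Var x))"
proof -
  have *: "deriv D (Imp (Var x) (Var x))" if "deriv D a" "x \<notin> vars a" for x a
    by (rule deriv_match_minor[OF deriv_K_arg deriv_weaken[OF that], where \<theta> = "Var(0 := Var x, 1 := a)"]) auto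
  \<comment> \<open>Two rounds are needed because the auxiliary theorem must avoid \<open>x\<close>:
    \<open>H1\<close> serves for 2, and the result serves for every other variable.\<close>
  have "deriv D (Imp (Var 2) (Var 2))"
    by (rule *[OF deriv_H1]) simp
  then show ?thesis by (cases "x = 2") (auto intro: *)
qed

text \<open>Detachment beneath an antecedent \<open>t\<close>. The minor premise is matched as it
  stands, so variables that \<open>t\<close> shares with the rest remain shared.\<close>

lemma deriv_under:
  assumes ab: "deriv D (Imp a b)" and t: "deriv D (Imp t (subst \<theta> a))"
    and new: "\<And>x. x \<in> vars b - vars a \<Longrightarrow> \<theta> x = Var (f x)"
    "inj_on f (vars b - vars a)"
    "\<And>x. x \<in> vars b - vars a \<Longrightarrow> f x \<notin> vars t \<union> vars (subst \<theta> a)"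
    and R: "R = Imp t (subst \<theta> b)" "good D R"
  shows "deriv D R"
proof -
  obtain v where v: "v \<notin> vars a \<union> vars b"
    using finite_fresh[of "vars a \<union> vars b"] by auto
  show ?thesis
    by (rule deriv_match_minor[OF deriv_compose_left[OF ab v] t, where \<theta> = "\<theta>(v := t)" and f = f])
      (use v new R in \<open>auto simp: inj_on_def\<close>)
qed

lemma deriv_under_K_arg: "deriv D (Imp t (Imp a b)) \<Longrightarrow> deriv D (Imp t (Imp a a))"
  by (rule deriv_under[OF deriv_K_arg, where \<theta> = "Var(0 := a, 1 := b)"]) (auto dest: deriv_good)

lemma deriv_under_swap: "deriv D (Imp t (Imp a (Imp b c))) \<Longrightarrow> deriv D (Imp t (Imp b (Imp a c)))"
  by (rule deriv_under[OF deriv_C, where \<theta> = "Var(0 := a, 1 := b, 2 := c)"]) (auto dest: deriv_good)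

lemma deriv_under_B:
  assumes "deriv D (Imp t (Imp b c))" "v \<notin> vars t \<union> vars b \<union> vars c"
  shows "deriv D (Imp t (Imp (Imp (Var v) b) (Imp (Var v) c)))"
  by (rule deriv_under[OF deriv_B, where \<theta> = "Var(0 := Var v, 1 := b, 2 := c)" and f = "\<lambda>_. v"])
    (use assms deriv_good[OF assms(1)] in \<open>auto simp: inj_on_def\<close>)

lemma deriv_under_B':
  assumes "deriv D (Imp t (Imp a b))" "v \<notin> vars t \<union> vars a \<union> vars b"
  shows "deriv D (Imp t (Imp (Imp b (Var v)) (Imp a (Var v))))"
  by (rule deriv_under[OF deriv_B', where \<theta> = "Var(0 := a, 1 := b, 2 := Var v)" and f = "\<lambda>_. v"])
    (use assms deriv_good[OF assms(1)] in \<open>auto simp: inj_on_def\<close>)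

text \<open>From the two antecedents \<open>H4\<close> refutes \<open>Var 2\<close> in the form
  \<open>Var 2\<close> implies anything; choosing \<open>Neg (Var 2)\<close> for "anything" lets
  \<open>H3\<close> conclude.\<close>

lemma deriv_contrapos:
  "deriv D (Imp (Imp (Var 2) (Var 0)) (Imp (Neg (Var 0)) (Neg (Var 2))))"
proof -
  have "deriv D (Imp (Imp (Var 3) (Imp (Var 4) (Imp (Var 0) (Neg (Var 0)))))
      (Imp (Var 3) (Imp (Var 4) (Neg (Var 0)))))" (is "deriv D (Imp ?A ?B)")
    by (rule deriv_compose_left, rule deriv_compose_left[OF deriv_H3]) auto
  moreover have "deriv D (Imp (Imp (Var 2) (Var 0)) (Imp (Neg (Var 0)) (Imp (Var 2) (Var 1))))" (is "deriv D ?Q")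
    by (rule deriv_under_swap, rule deriv_compose_left[OF deriv_H4]) auto
  ultimately show ?thesis
  proof (rule deriv_unify)
    let ?\<sigma>1 = "Var(3 := Imp (Var 2) (Var 0), 4 := Neg (Var 0), 0 := Var 2)" and ?\<sigma>2 = "Var(1 := Neg (Var 2))"
    show "subst ?\<sigma>1 ?A = subst ?\<sigma>2 ?Q" by simp
    show "Imp (Imp (Var 2) (Var 0)) (Imp (Neg (Var 0)) (Neg (Var 2))) = subst ?\<sigma>1 ?B" by simp
    show "\<exists>\<rho>. (\<forall>x\<in>vars (Imp ?A ?B). \<tau>1 x = subst \<rho> (?\<sigma>1 x)) \<and> (\<forall>x\<in>vars ?Q. \<tau>2 x = subst \<rho> (?\<sigma>2 x))"
      if "subst \<tau>1 ?A = subst \<tau>2 ?Q" for \<tau>1 \<tau>2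
      by (rule exI[of _ \<tau>2]) (use that in auto)
  qed simp
qed


section \<open>Identities over arbitrary formulas\<close>

primrec ctx :: "nat list \<Rightarrow> form \<Rightarrow> form" where
  "ctx [] F = F"
| "ctx (x # xs) F = Imp (Var x) (ctx xs F)"

lemma vars_ctx [simp]: "vars (ctx xs F) = set xs \<union> vars F"
  by (induction xs) auto

lemma good_ctx [simp]: "good D (ctx xs F) \<longleftrightarrow> good D F"
  by (induction xs) auto

lemma subst_ctx_upd: "z \<notin> set xs \<Longrightarrow> subst (Var(z := F)) (ctx xs G) = ctx xs (subst (Var(z := F)) G)"
  by (induction xs) auto

lemma deriv_ctx: "deriv D F \<Longrightarrow> distinct xs \<Longrightarrow> set xs \<inter> vars F = {} \<Longrightarrow> deriv D (ctx xs F)"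
  by (induction xs) (auto intro: deriv_weaken)

text \<open>Each new antecedent \<open>a\<close> is put before both sides. For \<open>x = a\<close>
  the old identity on \<open>y\<close> is overwritten by SK; otherwise \<open>a\<close> is first
  swapped inside, then SK discards it. The extra variable \<open>y\<close> ensures that there is
  always an old identity.\<close>

lemma deriv_ctx_id_var:
  assumes "distinct (xs @ [y, z])" "x \<in> set (xs @ [y])"
  shows "deriv D (Imp (ctx (xs @ [y]) (Var z)) (Imp (Var x) (Var x)))"
  using assms
proof (induction xs arbitrary: x)
  case Nil
  have "deriv D (Imp (Var y) (Imp (Var z) (Var y)))"
    by (rule deriv_under[OF deriv_H1, where \<theta> = "Var(0 := Var y, 1 := Var z)" and f = "\<lambda>_. z"])
      (use Nil deriv_id in \<open>auto simp: inj_on_def\<close>)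
  then show ?case using Nil by (auto intro: deriv_distrib)
next
  case (Cons a xs)
  let ?G = "ctx (xs @ [y]) (Var z)"
  have *: "deriv D (Imp (Imp (Var a) ?G) (Imp (Var a) (Imp (Var b) (Var b))))" if "b \<in> set (xs @ [y])" for b
    by (rule deriv_compose_left[OF Cons.IH]) (use that Cons.prems in auto)
  show ?case
  proof (cases "x = a")
    case True
    then show ?thesis using deriv_under_K_arg[OF *[of y]] by simp
  next
    case False
    then have "x \<in> set (xs @ [y])" using Cons.prems by auto
    from deriv_under_K_arg[OF deriv_under_swap[OF *[OF this]]] show ?thesis by simp
  qed
qed

text \<open>If \<open>b\<close> is itself a negation, a new double negation arises here; hence the
  separate goodness assumption.\<close>

lemma deriv_under_id_Neg:
  assumes "deriv D (Imp g (Imp b b))" "good D (Neg b)"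
  shows "deriv D (Imp g (Imp (Neg b) (Neg b)))"
  by (rule deriv_under[OF deriv_contrapos, of _ g, where \<theta> = "Var(0 := b, 2 := b)"])
    (use assms deriv_good[OF assms(1)] in auto)

text \<open>The shared premise \<open>g\<close> contains all variables of \<open>b\<close> and \<open>c\<close>, so unifying the two
  copies of \<open>g\<close> keeps the variables common to \<open>b\<close> and \<open>c\<close> identified.\<close>

lemma deriv_under_id_Imp:
  assumes b: "deriv D (Imp g (Imp b b))" and c: "deriv D (Imp g (Imp c c))"
    and vars: "vars b \<subseteq> vars g" "vars c \<subseteq> vars g"
  shows "deriv D (Imp g (Imp (Imp b c) (Imp b c)))"
proof -
  obtain y where y: "y \<notin> vars g" using finite_fresh[of "vars g"] by auto
  obtain z where z: "z \<notin> insert y (vars g)" using finite_fresh[of "insert y (vars g)"] by auto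
  have yz: "y \<notin> vars b" "y \<notin> vars c" "z \<notin> vars b" "z \<notin> vars c" "z \<noteq> y" using y z vars by auto
  have "deriv D (Imp g (Imp (Imp b (Var y)) (Imp b (Var y))))"
    by (rule deriv_under_B'[OF b]) (use y yz in auto)
  then have "deriv D (Imp g (Imp (Imp (Imp b (Var y)) (Var z)) (Imp (Imp b (Var y)) (Var z))))"
    by (rule deriv_under_B') (use z yz in auto)
  \<comment> \<open>Distribution puts \<open>g\<close> inside the antecedent, where it meets the
    \<open>g\<close> of the other premise.\<close>
  then have "deriv D (Imp (Imp g (Imp (Imp b (Var y)) (Var z))) (Imp g (Imp (Imp b (Var y)) (Var z))))"
    (is "deriv D (Imp ?A ?A)")
    by (rule deriv_distrib)
  moreover have "deriv D (Imp g (Imp (Imp (Var y) c) (Imp (Var y) c)))" (is "deriv D ?Q")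
    by (rule deriv_under_B[OF c]) (use y yz in auto)
  ultimately show ?thesis
  proof (rule deriv_unify)
    \<comment> \<open>The two occurrences of \<open>y\<close> belong to different premises: one is
      forced to be \<open>c\<close>, the other \<open>b\<close>, and \<open>z\<close> takes the
      consequent.\<close>
    let ?\<sigma>1 = "Var(y := c, z := Imp b c)" and ?\<sigma>2 = "Var(y := b)"
    show "subst ?\<sigma>1 ?A = subst ?\<sigma>2 ?Q" using y z yz by simp
    show "Imp g (Imp (Imp b c) (Imp b c)) = subst ?\<sigma>1 ?A" using y z yz by simp
    show "\<exists>\<rho>. (\<forall>x\<in>vars (Imp ?A ?A). \<tau>1 x = subst \<rho> (?\<sigma>1 x)) \<and> (\<forall>x\<in>vars ?Q. \<tau>2 x = subst \<rho> (?\<sigma>2 x))"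
      if eq: "subst \<tau>1 ?A = subst \<tau>2 ?Q" for \<tau>1 \<tau>2
    proof -
      have g: "\<tau>1 x = \<tau>2 x" if "x \<in> vars g" for x
        using eq that by (simp add: subst_eq_iff)
      then have "subst \<tau>1 c = subst \<tau>2 c"
        using vars by (auto simp: subst_eq_iff)
      then show ?thesis using eq g y z yz vars by (intro exI[of _ \<tau>1]) auto
    qed
    show "good D (Imp g (Imp (Imp b c) (Imp b c)))"
      using deriv_good[OF b] deriv_good[OF c] by simp
  qed
qed

lemma deriv_id_good:
  assumes "good D A"
  shows "deriv D (Imp A A)"
proof -
  obtain y where y: "y \<notin> vars A" using finite_fresh[of "vars A"] by auto
  obtain z where z: "z \<notin> insert y (vars A)" using finite_fresh[of "insert y (vars A)"] by auto
  obtain xs where xs: "set xs = vars A" "distinct xs"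
    using finite_distinct_list[OF finite_vars] by blast
  let ?g = "ctx (xs @ [y]) (Var z)"
  have "deriv D (Imp ?g (Imp F F))" if "good D F" "vars F \<subseteq> vars A" for F
    using that
  proof (induction F)
    case (Var x)
    then show ?case by (intro deriv_ctx_id_var) (use xs y z in auto)
  next
    case (Imp b c)
    then show ?case by (intro deriv_under_id_Imp) (use xs in auto)
  next
    case (Neg b)
    then show ?case by (intro deriv_under_id_Neg) (auto dest: good_NegD)
  qed
  then have *: "deriv D (Imp ?g (Imp A A))" using assms by blast
  have "deriv D (ctx (xs @ [y]) (Imp (Var z) (Var z)))"
    by (rule deriv_ctx[OF deriv_id]) (use xs y z in auto)
  \<comment> \<open>\<open>z\<close> does not occur in \<open>A\<close>, so detaching the instance
    of the shared premise leaves the identity untouched.\<close>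
  then show ?thesis
    by (rule deriv_match_minor[OF *, where \<theta> = "Var(z := Imp (Var z) (Var z))"])
      (use xs y z assms in \<open>auto simp: subst_ctx_upd\<close>)
qed

section \<open>Good instances of the axioms\<close>

lemma deriv_instance:
  assumes "h \<in> axioms" "good D (subst \<theta> h)"
  shows "deriv D (subst \<theta> h)"
  using deriv_id_good[OF assms(2)] deriv.ax[OF assms(1)] cd_match_major assms(2) by (rule deriv.cd)

lemma deriv_H1_instance: "good D (Imp a (Imp b a)) \<Longrightarrow> deriv D (Imp a (Imp b a))"
  using deriv_instance[of H1 D "Var(0 := a, 1 := b)"] by (simp add: axioms_def H1_def)

lemma deriv_H2_instance:
  "good D (Imp a (Imp b c)) \<Longrightarrow> deriv D (Imp (Imp a (Imp b c)) (Imp (Imp a b) (Imp a c)))"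
  using deriv_instance[of H2 D "Var(0 := a, 1 := b, 2 := c)"] by (simp add: axioms_def H2_def)

lemma deriv_H3_instance:
  "good D (Neg a) \<Longrightarrow> deriv D (Imp (Imp a (Neg a)) (Neg a))"
  using deriv_instance[of H3 D "Var(0 := a)"] good_NegD by (simp add: axioms_def H3_def)

lemma deriv_H4_instance:
  "good D (Neg a) \<Longrightarrow> good D b \<Longrightarrow> deriv D (Imp a (Imp (Neg a) b))"
  using deriv_instance[of H4 D "Var(0 := a, 1 := b)"] good_NegD by (simp add: axioms_def H4_def)


section \<open>Deduction from good hypotheses\<close>

text \<open>Only modus ponens acts on hypotheses, so their variables behave as constants, as the
  deduction theorem requires.\<close>

inductive ded :: "form set \<Rightarrow> form set \<Rightarrow> form \<Rightarrow> bool" for D \<Gamma> where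
  hyp: "F \<in> \<Gamma> \<Longrightarrow> good D F \<Longrightarrow> ded D \<Gamma> F"
| der: "deriv D F \<Longrightarrow> ded D \<Gamma> F"
| mp: "ded D \<Gamma> (Imp F G) \<Longrightarrow> ded D \<Gamma> F \<Longrightarrow> ded D \<Gamma> G"

lemma ded_good: "ded D \<Gamma> F \<Longrightarrow> good D F"
  by (induction rule: ded.induct) (auto dest: deriv_good)

lemma ded_mono: "ded D \<Gamma> F \<Longrightarrow> \<Gamma> \<subseteq> \<Delta> \<Longrightarrow> ded D \<Delta> F"
  by (induction rule: ded.induct) (auto intro: ded.intros)

lemma ded_empty: "ded D {} F \<Longrightarrow> deriv D F"
  by (induction rule: ded.induct) (auto intro: deriv_mp)

text \<open>The usual argument by I, K and S survives the restriction because the instances used are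
  built from good formulas by \<open>Imp\<close> alone, which creates no double negation.\<close>

lemma deduction:
  assumes "ded D (insert F \<Gamma>) G" "good D F"
  shows "ded D \<Gamma> (Imp F G)"
  using assms
proof (induction rule: ded.induct)
  case (hyp G)
  show ?case
  proof (cases "G = F")
    case True
    then show ?thesis using hyp by (auto intro: ded.der deriv_id_good)
  next
    case False
    then have "ded D \<Gamma> G" using hyp by (auto intro: ded.hyp)
    moreover have "ded D \<Gamma> (Imp G (Imp F G))" using hyp by (intro ded.der deriv_H1_instance) auto
    ultimately show ?thesis by (rule ded.mp[rotated])
  qed
next
  case (der G)
  then have "ded D \<Gamma> (Imp G (Imp F G))" by (auto intro!: ded.der deriv_H1_instance dest: deriv_good)
  then show ?case using der by (blast intro: ded.intros)
next
  case (mp G H)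
  then have "ded D \<Gamma> (Imp (Imp F (Imp G H)) (Imp (Imp F G) (Imp F H)))"
    using ded_good by (intro ded.der deriv_H2_instance) fastforce
  then show ?case using mp by (blast intro: ded.mp)
qed


section \<open>Kripke semantics\<close>

primrec force :: "form set set \<Rightarrow> (form set \<Rightarrow> nat \<Rightarrow> bool) \<Rightarrow> form set \<Rightarrow> form \<Rightarrow> bool" where
  "force W V w (Var x) = V w x"
| "force W V w (Imp a b) = (\<forall>u\<in>W. w \<subseteq> u \<longrightarrow> force W V u a \<longrightarrow> force W V u b)"
| "force W V w (Neg a) = (\<forall>u\<in>W. w \<subseteq> u \<longrightarrow> \<not> force W V u a)"

definition persistent :: "form set set \<Rightarrow> (form set \<Rightarrow> nat \<Rightarrow> bool) \<Rightarrow> bool" where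
  "persistent W V \<longleftrightarrow> (\<forall>w\<in>W. \<forall>u\<in>W. w \<subseteq> u \<longrightarrow> (\<forall>x. V w x \<longrightarrow> V u x))"

text \<open>Quantifying over all persistent valuations makes validity closed under
  substitution.\<close>

definition valid :: "form set set \<Rightarrow> form \<Rightarrow> bool" where
  "valid W F \<longleftrightarrow> (\<forall>V. persistent W V \<longrightarrow> (\<forall>w\<in>W. force W V w F))"

section \<open>Soundness of condensed detachment\<close>

lemma force_persistent:
  "persistent W V \<Longrightarrow> w \<in> W \<Longrightarrow> u \<in> W \<Longrightarrow> w \<subseteq> u \<Longrightarrow> force W V w F \<Longrightarrow> force W V u F"
  by (induction F) (auto simp: persistent_def)

lemma force_subst: "force W V w (subst \<sigma> F) = force W (\<lambda>w x. force W V w (\<sigma> x)) w F"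
  by (induction F arbitrary: w) auto

text \<open>A substitution is absorbed into the valuation, which stays persistent because forcing
  is.\<close>

lemma valid_subst:
  assumes "valid W F"
  shows "valid W (subst \<sigma> F)"
  unfolding valid_def
proof (intro allI impI ballI)
  fix V w assume "persistent W V" "w \<in> W"
  then have "persistent W (\<lambda>w x. force W V w (\<sigma> x))"
    unfolding persistent_def[of W "\<lambda>w x. force W V w (\<sigma> x)"] using force_persistent by blast
  then show "force W V w (subst \<sigma> F)"
    using assms \<open>w \<in> W\<close> by (simp add: valid_def force_subst)
qed

lemma valid_variant: "valid W F \<Longrightarrow> variant F G \<Longrightarrow> valid W G"
  unfolding variant_def by (auto intro: valid_subst)

lemma valid_cd:
  assumes "valid W P" "valid W Q" "cd P Q R"
  shows "valid W R"
proof -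
  obtain P' Q' A B \<sigma> where *: "variant P P'" "variant Q Q'" "P' = Imp A B"
    "subst \<sigma> A = subst \<sigma> Q'" "variant (subst \<sigma> B) R"
    using assms(3) unfolding cd_def mgu_def unifier_def by blast
  have "valid W (subst \<sigma> (Imp A B))" "valid W (subst \<sigma> A)"
    using assms * valid_variant valid_subst by metis+
  then have "valid W (subst \<sigma> B)" by (auto simp: valid_def)
  then show ?thesis using * valid_variant by blast
qed

lemma valid_axiom:
  assumes "h \<in> axioms"
  shows "valid W h"
proof -
  have "force W V w h" if V: "persistent W V" and "w \<in> W" for V w
  proof -
    have p: "V u x" if "V v x" "v \<in> W" "u \<in> W" "v \<subseteq> u" for u v x
      using V that by (auto simp: persistent_def)
    consider "h = H1" | "h = H2" | "h = H3" | "h = H4" using assms by (auto simp: axioms_def)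
    then show ?thesis
    proof cases
      case 1 then show ?thesis using p by (auto simp: H1_def)
    next
      case 2 then show ?thesis by (simp add: H2_def)
    next
      case 3 show ?thesis unfolding 3 H3_def force.simps by (meson order_refl)
    next
      case 4 show ?thesis unfolding 4 H4_def force.simps using p by (meson order_refl)
    qed
  qed
  then show ?thesis by (simp add: valid_def)
qed

lemma is_proof_valid:
  assumes "is_proof ps" "k < length ps"
  shows "valid W (ps ! k)"
  using assms(2)
proof (induction k rule: less_induct)
  case (less k)
  then consider h where "h \<in> axioms" "variant h (ps ! k)"
    | i j where "i < k" "j < k" "cd (ps ! i) (ps ! j) (ps ! k)"
    using assms(1) unfolding is_proof_def by blast
  then show ?case
  proof cases
    case 1 then show ?thesis using valid_axiom valid_variant by blast
  next
    case 2
    then have "valid W (ps ! i)" "valid W (ps ! j)" using less by simp_all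
    then show ?thesis using 2 valid_cd by blast
  qed
qed

lemma provable_valid: "provable A \<Longrightarrow> valid W A"
  unfolding provable_def proof_of_def
  by (metis diff_less is_proof_def is_proof_valid last_conv_nth length_greater_0_conv zero_less_one)

section \<open>The canonical model of restricted deduction\<close>

text \<open>Without a falsum, consistency means that some good formula is not deducible. Primeness
  is not imposed, the language having no disjunction.\<close>

definition worlds :: "form set \<Rightarrow> form set set" where
  "worlds D = {w. (\<forall>F\<in>w. good D F) \<and> (\<exists>G. good D G \<and> \<not> ded D w G)}"

text \<open>By the deduction theorem \<open>G\<close> itself witnesses that the enlarged set is
  consistent.\<close>

lemma worlds_insert:
  assumes "w \<in> worlds D" "good D F" "good D G" "\<not> ded D w (Imp F G)"
  shows "insert F w \<in> worlds D" "\<not> ded D (insert F w) G"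
  using assms deduction unfolding worlds_def by blast+

lemma force_iff_ded:
  "good D F \<Longrightarrow> w \<in> worlds D \<Longrightarrow> force (worlds D) (\<lambda>w x. ded D w (Var x)) w F \<longleftrightarrow> ded D w F"
proof (induction F arbitrary: w)
  case (Var x)
  show ?case by simp
next
  case (Imp a b)
  then have good: "good D a" "good D b" by auto
  have "(\<forall>u\<in>worlds D. w \<subseteq> u \<longrightarrow> ded D u a \<longrightarrow> ded D u b) \<longleftrightarrow> ded D w (Imp a b)"
  proof
    assume *: "\<forall>u\<in>worlds D. w \<subseteq> u \<longrightarrow> ded D u a \<longrightarrow> ded D u b"
    show "ded D w (Imp a b)"
    proof (rule ccontr)
      assume "\<not> ded D w (Imp a b)"
      from worlds_insert[OF Imp.prems(2) good this] * show False
        using good by (blast intro: ded.hyp)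
    qed
  qed (blast intro: ded.mp ded_mono)
  then show ?case using Imp good by simp
next
  case (Neg a)
  then have good: "good D a" by (blast dest: good_NegD)
  have "(\<forall>u\<in>worlds D. w \<subseteq> u \<longrightarrow> \<not> ded D u a) \<longleftrightarrow> ded D w (Neg a)"
  proof
    assume *: "\<forall>u\<in>worlds D. w \<subseteq> u \<longrightarrow> \<not> ded D u a"
    \<comment> \<open>\<open>Neg a\<close> plays the part of falsum: if it did not follow from
      \<open>a\<close>, adding \<open>a\<close> would give a world deducing \<open>a\<close>.
      \<open>H3\<close> then yields \<open>Neg a\<close>.\<close>
    have "ded D w (Imp a (Neg a))"
    proof (rule ccontr)
      assume "\<not> ded D w (Imp a (Neg a))"
      from worlds_insert[OF Neg.prems(2) good Neg.prems(1) this] * show False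
        using good by (blast intro: ded.hyp)
    qed
    then show "ded D w (Neg a)"
      using deriv_H3_instance[OF Neg.prems(1)] by (blast intro: ded.intros)
  next
    assume neg: "ded D w (Neg a)"
    show "\<forall>u\<in>worlds D. w \<subseteq> u \<longrightarrow> \<not> ded D u a"
    proof (intro ballI impI notI)
      fix u assume u: "u \<in> worlds D" "w \<subseteq> u" "ded D u a"
      \<comment> \<open>By \<open>H4\<close>, a world with both \<open>a\<close> and
        \<open>Neg a\<close> would deduce even its consistency witness \<open>G\<close>.\<close>
      then obtain G where "good D G" "\<not> ded D u G" by (auto simp: worlds_def)
      then show False
        using deriv_H4_instance[OF Neg.prems(1)] u ded_mono[OF neg u(2)] by (blast intro: ded.intros)
    qed
  qed
  then show ?case using Neg good by simp
qed

text \<open>If \<open>A\<close> were not derivable, the empty set would be a world with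
  \<open>A\<close> as witness, and \<open>A\<close> would fail there.\<close>

lemma valid_deriv:
  assumes "valid (worlds D) A" "good D A"
  shows "deriv D A"
proof (rule ccontr)
  assume "\<not> deriv D A"
  then have *: "\<not> ded D {} A" using ded_empty by blast
  then have "{} \<in> worlds D" using assms(2) by (auto simp: worlds_def)
  moreover have "persistent (worlds D) (\<lambda>w x. ded D w (Var x))"
    by (auto simp: persistent_def intro: ded_mono)
  ultimately show False
    using assms * force_iff_ded by (auto simp: valid_def)
qed

theorem theorem9:
  assumes "provable A"
  shows "\<exists>ps. proof_of ps A \<and>
           (\<forall>F \<in> set ps. \<forall>t \<in> subforms F. doubly_negated t \<longrightarrow> t \<in> subforms A)"
proof -
  have "deriv (subforms A) A"
    using provable_valid[OF assms] by (rule valid_deriv) (simp add: good_def)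
  then show ?thesis using deriv_proof unfolding good_def by blast
qed

end
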